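(* Fix positive integers $p,q$ such that $2 < \frac{p}{q} < 4$. A graph $G$ is $(p,q)$-mixing if and only if for every $(p,q)$-colouring $f$ of $G$ and for every cycle $C$ in $G$, the wind of $C$ under $f$ satisfies $w_f(C) = \frac{|E(C)|}{2}$.
   Context: Graphs are finite and simple. A $(p,q)$-colouring of $G$ is a map $f: V(G) \to \{0,1,\dots,p-1\}$ such that $q \leq |f(u)-f(v)| \leq p-q$ for every edge $uv$. $G$ is $(p,q)$-mixing if any two $(p,q)$-colourings $f,g$ of $G$ are joined by a finite sequence of $(p,q)$-colourings of $G$ in which consecutive colourings differ on at most one vertex (vacuously true if $G$ has no $(p,q)$-colouring). For an edge $uv$ (with direction from $u$ to $v$), its weight is $W(uv,f) = (f(v)-f(u)) \bmod p \in \{0,\dots,p-1\}$. For a cycle $C = c_0,c_1,\dots,c_{l-1},c_0$ (traversed in a given direction), $W(C,f)$ is the sum of the weights of its $l$ edges directed consistently along the traversal; this is an integer multiple of $p$, and the wind $w_f(C)$ is the integer with $W(C,f) = p\cdot w_f(C)$. (Reversing the direction replaces $w_f(C)$ by $|E(C)|-w_f(C)$, so the condition $w_f(C)=|E(C)|/2$ does not depend on the direction.) *)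

theory Defs
  imports Complex_Main "HOL-Library.FuncSet" "Graph_Theory.Pair_Digraph"
begin

text \<open>
  A finite simple graph is a \<^locale>\<open>pair_graph\<close>: the relation \<^term>\<open>parcs G\<close> contains both
  orientations \<open>(u, v)\<close> and \<open>(v, u)\<close> of each edge. Colourings are extensional functions, so
  that equality of colourings is equality on the vertex set.
\<close>

definition colourings :: "nat \<Rightarrow> nat \<Rightarrow> 'a pair_pre_digraph \<Rightarrow> ('a \<Rightarrow> int) set" where
  "colourings p q G =
    {f \<in> pverts G \<rightarrow>\<^sub>E {0..<int p}.
      \<forall>(u, v) \<in> parcs G. int q \<le> \<bar>f u - f v\<bar> \<and> \<bar>f u - f v\<bar> \<le> int p - int q}"

definition mixing :: "nat \<Rightarrow> nat \<Rightarrow> 'a pair_pre_digraph \<Rightarrow> bool" where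
  "mixing p q G \<longleftrightarrow>
    (\<forall>f \<in> colourings p q G. \<forall>g \<in> colourings p q G.
      \<exists>hs. hs \<noteq> [] \<and> hd hs = f \<and> last hs = g \<and> set hs \<subseteq> colourings p q G \<and>
        successively (\<lambda>h k. card {v \<in> pverts G. h v \<noteq> k v} \<le> 1) hs)"

text \<open>
  A traversal of a cycle is the list of its consecutively directed arcs, so its length is the
  number of edges. The library's notion of cycle in a symmetric digraph admits the closed walk
  \<open>u, v, u\<close> along a single edge, which is not a cycle of a simple graph; hence the bound 3.
\<close>

definition graph_cycle :: "'a pair_pre_digraph \<Rightarrow> ('a \<times> 'a) list \<Rightarrow> bool" where
  "graph_cycle G C \<longleftrightarrow> pre_digraph.cycle (with_proj G) C \<and> 3 \<le> length C"

definition arc_weight :: "nat \<Rightarrow> ('a \<Rightarrow> int) \<Rightarrow> 'a \<times> 'a \<Rightarrow> int" where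
  "arc_weight p f e = (f (snd e) - f (fst e)) mod int p"

definition cycle_weight :: "nat \<Rightarrow> ('a \<Rightarrow> int) \<Rightarrow> ('a \<times> 'a) list \<Rightarrow> int" where
  "cycle_weight p f C = (\<Sum>e\<leftarrow>C. arc_weight p f e)"

text \<open>On cycles the following division is exact, see \<open>cycle_weight_eq_wind\<close>.\<close>

definition wind :: "nat \<Rightarrow> ('a \<Rightarrow> int) \<Rightarrow> ('a \<times> 'a) list \<Rightarrow> int" where
  "wind p f C = cycle_weight p f C div int p"

lemma pcas_dvd_cycle_weight:
  "pcas u C v \<Longrightarrow> int p dvd cycle_weight p f C - (f v - f u)"
proof (induction u C v rule: pcas.induct)
  case (1 u v)
  then show ?case by (simp add: cycle_weight_def)
next
  case (2 u e es v)
  have "int p dvd arc_weight p f e - (f (snd e) - f (fst e))"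
    unfolding arc_weight_def by (simp add: mod_eq_dvd_iff[symmetric])
  moreover have "int p dvd cycle_weight p f es - (f v - f (snd e))"
    using 2 by simp
  ultimately have "int p dvd (arc_weight p f e - (f (snd e) - f (fst e)))
      + (cycle_weight p f es - (f v - f (snd e)))"
    by (rule dvd_add)
  then show ?case
    using 2 by (simp add: cycle_weight_def algebra_simps)
qed

lemma cycle_weight_eq_wind:
  assumes "graph_cycle G C"
  shows "cycle_weight p f C = int p * wind p f C"
proof -
  from assms obtain u where "pcas u C u"
    by (auto simp: graph_cycle_def pre_digraph.cycle_def pre_digraph.awalk_def cas_with_proj_eq)
  from pcas_dvd_cycle_weight[OF this] show ?thesis
    by (simp add: wind_def)
qed

end

theory Submission
  imports Defs
begin

text \<open>
  Since \<open>p < 4 q\<close>, a recoloured vertex can slide from its old to its new colour along an arc of the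
  colour circle that meets no colour of a neighbour, so the weights change by a coboundary and winds
  are invariant under recolouring. The reflection \<open>x \<mapsto> p - 1 - x\<close> of the colours turns a wind \<open>w\<close>
  into \<open>\<bar>E(C)\<bar> - w\<close>, so mixing forces \<open>w = \<bar>E(C)\<bar> / 2\<close>.

  Conversely, if all winds are \<open>\<bar>E(C)\<bar> / 2\<close>, then \<open>2 W - p\<close> is the coboundary of a potential
  \<open>\<phi>\<close>, and any two colourings \<open>f\<close>, \<open>g\<close> differ by an integral shift \<open>\<psi>\<close> satisfying
  \<open>W(uv, g) = W(uv, f) + \<psi> v - \<psi> u\<close>. A global multiple of \<open>p\<close> makes \<open>\<psi>\<close> nonnegative, and then
  \<open>f\<close> is raised to \<open>g\<close> by unit steps: among the vertices still to be raised, one with least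
  \<open>\<phi>\<close> is never blocked by a neighbour.
\<close>

section \<open>Potentials on graphs\<close>

context pair_graph
begin

text \<open>By strong induction on the length. A closed walk that repeats a vertex splits into two
  shorter closed walks. One without repetition is a graph cycle, or it runs back and forth along one
  edge, and then antisymmetry cancels its two terms.\<close>

lemma closed_awalk_sum_zero:
  fixes w :: "'a \<times> 'a \<Rightarrow> 'b::ab_group_add"
  assumes antisym: "\<And>u v. (u, v) \<in> parcs G \<Longrightarrow> w (v, u) = - w (u, v)"
    and cycles: "\<And>C. graph_cycle G C \<Longrightarrow> (\<Sum>e\<leftarrow>C. w e) = 0"
    and walk: "awalk u p u"
  shows "(\<Sum>e\<leftarrow>p. w e) = 0"
  using walk
proof (induction "length p" arbitrary: p u rule: less_induct)
  case less
  show ?case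
  proof (cases "p = []")
    case False
    then obtain e es where p: "p = e # es" by (cases p) auto
    have e: "e \<in> parcs G" "fst e = u" and es: "awalk (snd e) es u"
      using less.prems unfolding p awalk_Cons_iff by auto
    show ?thesis
    proof (cases "distinct (tl (pawalk_verts u p))")
      case True
      with less.prems False have cyc: "cycle p" unfolding cycle_def by auto
      show ?thesis
      proof (cases "3 \<le> length p")
        case True
        with cyc show ?thesis by (intro cycles) (simp add: graph_cycle_def)
      next
        case short: False
        show ?thesis
        proof (cases es)
          case Nil
          with es e have "fst e = snd e" by (simp add: awalk_Nil_iff)
          with e pair_no_loops show ?thesis by blast
        next
          case (Cons e' es')
          with short p have "es' = []" by (cases es') auto
          with Cons es e have "e' = (snd e, fst e)"
            by (auto simp: awalk_Cons_iff awalk_Nil_iff prod_eq_iff)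
          moreover have "w (snd e, fst e) = - w e" using antisym[of "fst e" "snd e"] e(1) by simp
          ultimately show ?thesis using Cons \<open>es' = []\<close> by (simp add: p)
        qed
      qed
    next
      case False
      with p have "\<not> distinct (pawalk_verts (snd e) es)" by simp
      \<comment> \<open>The detour \<open>r\<close> at the repeated vertex \<open>x\<close> is cut
        out. It is shorter than \<open>p\<close> because it lacks \<open>e\<close>; the remaining
        walk \<open>e # q @ s\<close> is shorter because \<open>r\<close> is nonempty.\<close>
      from awalk_not_distinct_decomp[OF es this] obtain q r s x where
        dec: "es = q @ r @ s" "r \<noteq> []"
        and w: "awalk (snd e) q x" "awalk x r x" "awalk x s u"
        by auto
      have "awalk u (e # q @ s) u"
        unfolding awalk_Cons_iff using awalk_appendI[OF w(1,3)] e by auto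
      then have "(\<Sum>e\<leftarrow>e # q @ s. w e) = 0"
        using dec by (intro less.hyps) (auto simp: p)
      moreover have "(\<Sum>e\<leftarrow>r. w e) = 0"
        by (rule less.hyps[OF _ w(2)]) (simp add: p dec)
      ultimately show ?thesis by (simp add: p dec)
    qed
  qed simp
qed

text \<open>The potential at a vertex is the sum of \<open>w\<close> along a chosen walk from a root
  of its component. Vanishing on closed walks makes this independent of the choice.\<close>

lemma potential_exists:
  fixes w :: "'a \<times> 'a \<Rightarrow> 'b::ab_group_add"
  assumes antisym: "\<And>u v. (u, v) \<in> parcs G \<Longrightarrow> w (v, u) = - w (u, v)"
    and cycles: "\<And>C. graph_cycle G C \<Longrightarrow> (\<Sum>e\<leftarrow>C. w e) = 0"
  obtains \<phi> :: "'a \<Rightarrow> 'b" where "\<And>u v. (u, v) \<in> parcs G \<Longrightarrow> \<phi> v - \<phi> u = w (u, v)"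
proof -
  \<comment> \<open>The choice depends only on which vertices reach \<open>v\<close>. Adjacent
    vertices are reached by the same vertices, hence get literally the same root.\<close>
  define root where "root v = (SOME r. r \<rightarrow>\<^sup>*\<^bsub>G\<^esub> v)" for v
  define path where "path v = (SOME p. awalk (root v) p v)" for v
  have root: "root v \<rightarrow>\<^sup>*\<^bsub>G\<^esub> v" if "v \<in> pverts G" for v
    unfolding root_def by (rule someI[where x = v]) (rule reachable_refl[OF that])
  have path: "awalk (root v) (path v) v" if "v \<in> pverts G" for v
    unfolding path_def by (rule someI_ex) (use root[OF that] in \<open>simp add: reachable_awalk\<close>)
  have "(\<Sum>e\<leftarrow>path v. w e) - (\<Sum>e\<leftarrow>path u. w e) = w (u, v)" if uv: "(u, v) \<in> parcs G" for u v
  proof -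
    have V: "u \<in> pverts G" "v \<in> pverts G" using uv by (auto dest: wellformed')
    have "u \<rightarrow>\<^sup>*\<^bsub>G\<^esub> v" using uv by (simp add: reachable_adjI)
    moreover from this have "v \<rightarrow>\<^sup>*\<^bsub>G\<^esub> u" by (rule symmetric_reachable')
    ultimately have "r \<rightarrow>\<^sup>*\<^bsub>G\<^esub> u \<longleftrightarrow> r \<rightarrow>\<^sup>*\<^bsub>G\<^esub> v" for r
      by (blast intro: reachable_trans)
    then have root_eq: "root v = root u" by (simp add: root_def)
    \<comment> \<open>The return walk \<open>q\<close> closes both root walks, one of them extended
      by the arc \<open>(u, v)\<close>. Subtracting the two zero sums cancels the contribution of
      \<open>q\<close>.\<close>
    obtain q where q: "awalk v q (root u)"
      using symmetric_reachable'[OF root[OF V(2)]] by (auto simp: reachable_awalk root_eq)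
    have "awalk (root u) (path u @ (u, v) # q) (root u)"
      using path[OF V(1)] q uv by (intro awalk_appendI[of _ _ u]) (auto simp: awalk_Cons_iff)
    moreover have "awalk (root u) (path v @ q) (root u)"
      using path[OF V(2)] q by (intro awalk_appendI[of _ _ v]) (auto simp: root_eq)
    ultimately have "(\<Sum>e\<leftarrow>path u @ (u, v) # q. w e) = 0" "(\<Sum>e\<leftarrow>path v @ q. w e) = 0"
      using closed_awalk_sum_zero[OF antisym cycles] by blast+
    then show ?thesis by (simp add: algebra_simps add_eq_0_iff2)
  qed
  then show ?thesis by (rule that)
qed

end

section \<open>Sums around cycles\<close>

lemma pcas_sum_coboundary:
  fixes d :: "'a \<Rightarrow> 'b::ab_group_add"
  shows "pcas u C v \<Longrightarrow> (\<Sum>e\<leftarrow>C. d (snd e) - d (fst e)) = d v - d u"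
  by (induction u C v rule: pcas.induct) auto

lemma graph_cycleE:
  assumes "graph_cycle G C"
  obtains u where "pcas u C u" "set C \<subseteq> parcs G"
  using assms
  by (auto simp: graph_cycle_def pre_digraph.cycle_def pre_digraph.awalk_def cas_with_proj_eq)

text \<open>The differences of \<open>d\<close> telescope to zero around a cycle. The invariance of
  winds under recolouring rests on this.\<close>

lemma cycle_weight_coboundary:
  assumes "graph_cycle G C"
    and "\<And>e. e \<in> parcs G \<Longrightarrow> arc_weight p g e = arc_weight p f e + (d (snd e) - d (fst e))"
  shows "cycle_weight p g C = cycle_weight p f C"
proof -
  from assms(1) obtain u where C: "pcas u C u" "set C \<subseteq> parcs G" by (rule graph_cycleE)
  have "cycle_weight p g C = (\<Sum>e\<leftarrow>C. arc_weight p f e + (d (snd e) - d (fst e)))"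
    unfolding cycle_weight_def using C(2) assms(2)
    by (intro arg_cong[where f = sum_list] map_cong) auto
  also have "\<dots> = cycle_weight p f C + (\<Sum>e\<leftarrow>C. d (snd e) - d (fst e))"
    by (simp add: sum_list_addf cycle_weight_def)
  finally show ?thesis by (simp add: pcas_sum_coboundary[OF C(1)])
qed

section \<open>Arc weights of colourings\<close>

text \<open>The residue is \<open>b - a\<close> or \<open>b - a + p\<close>, and the interval from
  \<open>q\<close> to \<open>p - q\<close> is symmetric under subtraction from \<open>p\<close>.
  Colourings can thus be handled through weights of directed arcs.\<close>

lemma circular_distance_iff:
  fixes a b p q :: int
  assumes "0 \<le> a" "a < p" "0 \<le> b" "b < p" "0 < q"
  shows "q \<le> \<bar>a - b\<bar> \<and> \<bar>a - b\<bar> \<le> p - q \<longleftrightarrow> (b - a) mod p \<in> {q..p - q}"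
proof (cases "a \<le> b")
  case True
  then have "(b - a) mod p = b - a" using assms by (intro mod_pos_pos_trivial) auto
  with True show ?thesis by auto
next
  case False
  have "(b - a) mod p = (b - a + p) mod p" by simp
  also have "\<dots> = b - a + p" using False assms by (intro mod_pos_pos_trivial) auto
  finally show ?thesis using False by auto
qed

lemma colourings_iff_arc_weight:
  assumes "pair_graph G" "q > 0"
  shows "f \<in> colourings p q G \<longleftrightarrow> f \<in> pverts G \<rightarrow>\<^sub>E {0..<int p} \<and>
    (\<forall>e \<in> parcs G. arc_weight p f e \<in> {int q..int p - int q})"
proof -
  interpret pair_graph G by fact
  have "(case e of (u, v) \<Rightarrow> int q \<le> \<bar>f u - f v\<bar> \<and> \<bar>f u - f v\<bar> \<le> int p - int q) \<longleftrightarrow>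
      arc_weight p f e \<in> {int q..int p - int q}"
    if f: "f \<in> pverts G \<rightarrow>\<^sub>E {0..<int p}" and e: "e \<in> parcs G" for e
  proof -
    have "fst e \<in> pverts G" "snd e \<in> pverts G"
      using e arc_fst_in_verts arc_snd_in_verts by auto
    with f have "f (fst e) \<in> {0..<int p}" "f (snd e) \<in> {0..<int p}" by auto
    with circular_distance_iff[of "f (fst e)" "int p" "f (snd e)" "int q"] \<open>q > 0\<close>
    show ?thesis by (auto simp: arc_weight_def case_prod_beta)
  qed
  then show ?thesis unfolding colourings_def by blast
qed

lemma arc_weight_bounds:
  assumes "pair_graph G" "q > 0" "f \<in> colourings p q G" "e \<in> parcs G"
  shows "int q \<le> arc_weight p f e" "arc_weight p f e \<le> int p - int q"
  using assms by (auto simp: colourings_iff_arc_weight)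

lemma arc_weight_swap:
  assumes "arc_weight p f (u, v) \<noteq> 0"
  shows "arc_weight p f (v, u) = int p - arc_weight p f (u, v)"
  using assms zmod_zminus1_eq_if[of "f v - f u" "int p"] by (simp add: arc_weight_def)

lemma colouring_arc_weight_swap:
  assumes "pair_graph G" "q > 0" "f \<in> colourings p q G" "(u, v) \<in> parcs G"
  shows "arc_weight p f (v, u) = int p - arc_weight p f (u, v)"
  using arc_weight_bounds[OF assms] \<open>q > 0\<close> by (intro arc_weight_swap) auto

section \<open>Mixing forces the wind\<close>

text \<open>A displacement \<open>D\<close> below \<open>2 * q\<close> cannot wrap around: wrapping
  would give \<open>y + D - p\<close>, at most \<open>D - q\<close> and so below \<open>q\<close>.
  If \<open>p - D\<close> is below \<open>2 * q\<close> it must wrap, since \<open>y + D\<close> is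
  at least \<open>q + D\<close> and so exceeds \<open>p - q\<close>.\<close>

lemma bounded_mod_shift:
  fixes p q D y :: int
  assumes "0 < q" "0 \<le> D" "D < p" "q \<le> y" "y \<le> p - q"
    and z: "q \<le> (y + D) mod p" "(y + D) mod p \<le> p - q"
  shows "D < 2 * q \<Longrightarrow> (y + D) mod p = y + D"
    and "p - D < 2 * q \<Longrightarrow> (y + D) mod p = y + (D - p)"
proof -
  have big: "(y + D) mod p = y + D - p" if "p \<le> y + D"
  proof -
    have "(y + D) mod p = (y + D - p) mod p" by simp
    also have "\<dots> = y + D - p" using assms that by (intro mod_pos_pos_trivial) auto
    finally show ?thesis .
  qed
  have small: "(y + D) mod p = y + D" if "y + D < p"
    using assms that by (intro mod_pos_pos_trivial) auto
  show "(y + D) mod p = y + D" if "D < 2 * q"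
    using big small z(1) assms(5) that by (cases "y + D < p") auto
  show "(y + D) mod p = y + (D - p)" if "p - D < 2 * q"
    using big small z(2) assms(4) that by (cases "y + D < p") auto
qed

text \<open>Only arcs at \<open>x\<close> change weight. All arcs into \<open>x\<close> change by
  one and the same integer, not merely by the same residue, and arcs out of \<open>x\<close> by its
  negative, as reversal replaces a weight by its complement to \<open>p\<close>.\<close>

lemma recolour_coboundary:
  assumes G: "pair_graph G" and "q > 0" "p < 4 * q"
    and f: "f \<in> colourings p q G" and h: "h \<in> colourings p q G"
    and eq: "\<And>v. v \<in> pverts G \<Longrightarrow> v \<noteq> x \<Longrightarrow> h v = f v"
  obtains d :: "'a \<Rightarrow> int" where
    "\<And>e. e \<in> parcs G \<Longrightarrow> arc_weight p h e = arc_weight p f e + (d (snd e) - d (fst e))"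
proof -
  interpret pair_graph G by fact
  define D where "D = (h x - f x) mod int p"
  \<comment> \<open>The signed displacement along the shorter way, of absolute value below
    \<open>2 * q\<close>: if \<open>D\<close> is at least \<open>2 * q\<close>, then
    \<open>p < 4 * q\<close> gives \<open>p - D < 2 * q\<close>. It does not depend on the neighbour
    \<open>u\<close>.\<close>
  define \<delta> where "\<delta> = (if D < 2 * int q then D else D - int p)"
  have in_arc: "arc_weight p h (u, x) = arc_weight p f (u, x) + \<delta>" if ux: "(u, x) \<in> parcs G" for u
  proof -
    have "u \<in> pverts G" "u \<noteq> x" using ux pair_no_loops[OF ux] by (auto dest: wellformed')
    then have "h u = f u" by (rule eq)
    note W = arc_weight_bounds[OF G \<open>q > 0\<close> f ux] arc_weight_bounds[OF G \<open>q > 0\<close> h ux]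
    have Wh: "arc_weight p h (u, x) = (arc_weight p f (u, x) + D) mod int p"
      unfolding D_def arc_weight_def by (simp add: mod_simps \<open>h u = f u\<close>)
    have "0 < int p" using W \<open>q > 0\<close> by linarith
    then have "0 \<le> D" "D < int p" by (simp_all add: D_def)
    then show ?thesis
      using bounded_mod_shift[of "int q" D "int p" "arc_weight p f (u, x)"] W Wh
        \<open>q > 0\<close> \<open>p < 4 * q\<close> by (auto simp: \<delta>_def)
  qed
  define d where "d v = (if v = x then \<delta> else 0)" for v
  have "arc_weight p h (u, v) = arc_weight p f (u, v) + (d v - d u)" if uv: "(u, v) \<in> parcs G" for u v
  proof -
    have V: "u \<in> pverts G" "v \<in> pverts G" "u \<noteq> v"
      using uv pair_no_loops[OF uv] by (auto dest: wellformed')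
    consider "v = x" | "u = x" | "u \<noteq> x" "v \<noteq> x" by blast
    then show ?thesis
    proof cases
      case 1
      with V in_arc uv show ?thesis by (simp add: d_def)
    next
      case 2
      have vx: "(v, x) \<in> parcs G" using uv arcs_symmetric 2 by blast
      from colouring_arc_weight_swap[OF G \<open>q > 0\<close> f vx] colouring_arc_weight_swap[OF G \<open>q > 0\<close> h vx]
        in_arc[OF vx] V 2 show ?thesis by (simp add: d_def)
    next
      case 3
      with V eq show ?thesis by (simp add: d_def arc_weight_def)
    qed
  qed
  then show ?thesis by (intro that[of d]) auto
qed

section \<open>Invariance of winds along recolouring sequences\<close>

lemma wind_recolour:
  assumes G: "pair_graph G" and "q > 0" "p < 4 * q"
    and "f \<in> colourings p q G" "h \<in> colourings p q G"
    and "card {v \<in> pverts G. f v \<noteq> h v} \<le> 1" "graph_cycle G C"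
  shows "wind p h C = wind p f C"
proof -
  interpret pair_graph G by fact
  have "is_singleton {v \<in> pverts G. f v \<noteq> h v} \<or> {v \<in> pverts G. f v \<noteq> h v} = {}"
    using assms(6) pair_finite_verts by (auto simp: is_singleton_altdef le_Suc_eq)
  then obtain x where "{v \<in> pverts G. f v \<noteq> h v} \<subseteq> {x}"
    by (auto simp: is_singleton_def)
  then have "h v = f v" if "v \<in> pverts G" "v \<noteq> x" for v
    using that by fastforce
  with assms(1-5) obtain d :: "'a \<Rightarrow> int" where
    "\<And>e. e \<in> parcs G \<Longrightarrow> arc_weight p h e = arc_weight p f e + (d (snd e) - d (fst e))"
    using recolour_coboundary by metis
  with assms(7) show ?thesis by (simp add: wind_def cycle_weight_coboundary)
qed

lemma wind_recolour_sequence: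
  assumes G: "pair_graph G" and "q > 0" "p < 4 * q" and C: "graph_cycle G C"
  shows "hs \<noteq> [] \<Longrightarrow> set hs \<subseteq> colourings p q G \<Longrightarrow>
    successively (\<lambda>h k. card {v \<in> pverts G. h v \<noteq> k v} \<le> 1) hs \<Longrightarrow>
    wind p (last hs) C = wind p (hd hs) C"
proof (induction hs rule: induct_list012)
  case (3 h k hs)
  then have "wind p k C = wind p h C"
    by (intro wind_recolour[OF G \<open>q > 0\<close> \<open>p < 4 * q\<close> _ _ _ C]) auto
  with 3 show ?case by simp
qed auto

text \<open>Reflection reverses the colour circle, so an arc takes the weight of its reverse. The
  offset \<open>- 1\<close> keeps the colours in \<open>{0..<int p}\<close>.\<close>

lemma reflected_colouring:
  assumes G: "pair_graph G" and "q > 0" and f: "f \<in> colourings p q G"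
  defines "g \<equiv> \<lambda>v\<in>pverts G. int p - 1 - f v"
  shows "g \<in> colourings p q G"
    and "e \<in> parcs G \<Longrightarrow> arc_weight p g e = int p - arc_weight p f e"
proof -
  interpret pair_graph G by fact
  show W: "arc_weight p g e = int p - arc_weight p f e" if "e \<in> parcs G" for e
  proof -
    obtain u v where e: "e = (u, v)" by (cases e)
    with that have "u \<in> pverts G" "v \<in> pverts G" by (auto dest: wellformed')
    then have "arc_weight p g (u, v) = arc_weight p f (v, u)"
      by (simp add: g_def arc_weight_def)
    with colouring_arc_weight_swap[OF G \<open>q > 0\<close> f] that e show ?thesis by simp
  qed
  have "g \<in> pverts G \<rightarrow>\<^sub>E {0..<int p}"
  proof -
    have "0 \<le> f v \<and> f v < int p" if "v \<in> pverts G" for v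
      using f that by (auto simp: colourings_def)
    then show ?thesis by (fastforce simp: g_def)
  qed
  then show "g \<in> colourings p q G"
    using W arc_weight_bounds[OF G \<open>q > 0\<close> f]
    by (fastforce simp: colourings_iff_arc_weight[OF G \<open>q > 0\<close>])
qed

lemma mixing_imp_wind:
  assumes G: "pair_graph G" and "q > 0" "p > 0" "p < 4 * q"
    and mix: "mixing p q G" and f: "f \<in> colourings p q G" and C: "graph_cycle G C"
  shows "2 * wind p f C = int (length C)"
proof -
  define g where "g = (\<lambda>v\<in>pverts G. int p - 1 - f v)"
  note g = reflected_colouring[OF G \<open>q > 0\<close> f, folded g_def]
  from mix f g(1) obtain hs where hs: "hs \<noteq> []" "hd hs = f" "last hs = g"
    "set hs \<subseteq> colourings p q G"
    "successively (\<lambda>h k. card {v \<in> pverts G. h v \<noteq> k v} \<le> 1) hs"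
    unfolding mixing_def by blast
  have same: "wind p g C = wind p f C"
    using wind_recolour_sequence[OF G \<open>q > 0\<close> \<open>p < 4 * q\<close> C hs(1,4,5)] hs(2,3) by simp
  have "set C \<subseteq> parcs G" using C by (rule graph_cycleE)
  then have "cycle_weight p g C = (\<Sum>e\<leftarrow>C. int p - arc_weight p f e)"
    unfolding cycle_weight_def using g(2) by (intro arg_cong[where f = sum_list] map_cong) auto
  also have "\<dots> = int p * int (length C) - cycle_weight p f C"
    by (simp add: sum_list_subtractf sum_list_triv cycle_weight_def mult.commute)
  finally have "int p * (2 * wind p f C) = int p * int (length C)"
    using same by (simp add: cycle_weight_eq_wind[OF C] algebra_simps)
  with \<open>p > 0\<close> show ?thesis by simp
qed

section \<open>The wind condition forces mixing\<close>

text \<open>The inner existential of \<open>mixing\<close>, isolated so that sequences can be built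
  one recolouring at a time.\<close>

definition joined :: "nat \<Rightarrow> nat \<Rightarrow> 'a pair_pre_digraph \<Rightarrow> ('a \<Rightarrow> int) \<Rightarrow> ('a \<Rightarrow> int) \<Rightarrow> bool" where
  "joined p q G f g \<longleftrightarrow>
    (\<exists>hs. hs \<noteq> [] \<and> hd hs = f \<and> last hs = g \<and> set hs \<subseteq> colourings p q G \<and>
      successively (\<lambda>h k. card {v \<in> pverts G. h v \<noteq> k v} \<le> 1) hs)"

lemma joined_refl: "f \<in> colourings p q G \<Longrightarrow> joined p q G f f"
  unfolding joined_def by (rule exI[of _ "[f]"]) simp

lemma joined_step:
  assumes "f \<in> colourings p q G" "card {v \<in> pverts G. f v \<noteq> h v} \<le> 1" "joined p q G h g"
  shows "joined p q G f g"
proof -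
  from assms(3) obtain hs where "hs \<noteq> []" "hd hs = h" "last hs = g" "set hs \<subseteq> colourings p q G"
    "successively (\<lambda>h k. card {v \<in> pverts G. h v \<noteq> k v} \<le> 1) hs"
    unfolding joined_def by blast
  with assms(1,2) show ?thesis
    unfolding joined_def by (intro exI[of _ "f # hs"]) (auto simp: successively_Cons)
qed

text \<open>The displacement is an integer and not a residue: it records how far, with full turns,
  each vertex travels round the colour circle. Outside the graph the result stays
  \<open>undefined\<close>, as for every colouring.\<close>

definition shift :: "nat \<Rightarrow> 'a pair_pre_digraph \<Rightarrow> ('a \<Rightarrow> int) \<Rightarrow> ('a \<Rightarrow> int) \<Rightarrow> 'a \<Rightarrow> int" where
  "shift p G f \<psi> = (\<lambda>v\<in>pverts G. (f v + \<psi> v) mod int p)"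

text \<open>The displaced weight is congruent to the new weight and already lies strictly between 0
  and \<open>p\<close>, so no reduction takes place.\<close>

lemma shift_colouring:
  assumes G: "pair_graph G" and "q > 0" "p > 0"
    and ok: "\<And>u v. (u, v) \<in> parcs G \<Longrightarrow>
      arc_weight p f (u, v) + (\<psi> v - \<psi> u) \<in> {int q..int p - int q}"
  shows "shift p G f \<psi> \<in> colourings p q G"
    and "(u, v) \<in> parcs G \<Longrightarrow>
      arc_weight p (shift p G f \<psi>) (u, v) = arc_weight p f (u, v) + (\<psi> v - \<psi> u)"
proof -
  interpret pair_graph G by fact
  show W: "arc_weight p (shift p G f \<psi>) (u, v) = arc_weight p f (u, v) + (\<psi> v - \<psi> u)"
    if uv: "(u, v) \<in> parcs G" for u v
  proof -
    have "u \<in> pverts G" "v \<in> pverts G" using uv by (auto dest: wellformed')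
    then have "arc_weight p (shift p G f \<psi>) (u, v)
        = (arc_weight p f (u, v) + (\<psi> v - \<psi> u)) mod int p"
      unfolding arc_weight_def by (simp add: shift_def mod_simps) (simp add: algebra_simps)
    also have "\<dots> = arc_weight p f (u, v) + (\<psi> v - \<psi> u)"
      using ok[OF uv] \<open>q > 0\<close> by (intro mod_pos_pos_trivial) auto
    finally show ?thesis .
  qed
  have "shift p G f \<psi> \<in> pverts G \<rightarrow>\<^sub>E {0..<int p}"
    using \<open>p > 0\<close> by (auto simp: shift_def)
  then show "shift p G f \<psi> \<in> colourings p q G"
    using W ok by (auto simp: colourings_iff_arc_weight[OF G \<open>q > 0\<close>])
qed

lemma shift_eqI:
  assumes "g \<in> colourings p q G" "\<And>v. v \<in> pverts G \<Longrightarrow> int p dvd g v - (f v + \<psi> v)"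
  shows "shift p G f \<psi> = g"
proof
  fix v
  show "shift p G f \<psi> v = g v"
  proof (cases "v \<in> pverts G")
    case True
    with assms have "g v mod int p = (f v + \<psi> v) mod int p" by (simp add: mod_eq_dvd_iff)
    moreover have "g v mod int p = g v"
      using assms(1) True by (intro mod_pos_pos_trivial) (auto simp: colourings_def)
    ultimately show ?thesis using True by (simp add: shift_def)
  next
    case False
    with assms(1) show ?thesis by (auto simp: shift_def colourings_def)
  qed
qed

text \<open>Induction on the total displacement, raising one vertex by one colour at a time. A
  vertex blocking another one has strictly smaller potential and must itself still be raised, so a
  pending vertex of least potential is free.\<close>

lemma joined_shift:
  fixes f \<psi> \<phi> :: "'a \<Rightarrow> int"
  assumes G: "pair_graph G" and q: "q > 0" "2 * q < p"
    and "f \<in> colourings p q G"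
    and "\<And>u v. (u, v) \<in> parcs G \<Longrightarrow> \<phi> v - \<phi> u = 2 * arc_weight p f (u, v) - int p"
    and "\<And>v. v \<in> pverts G \<Longrightarrow> 0 \<le> \<psi> v"
    and "\<And>u v. (u, v) \<in> parcs G \<Longrightarrow>
      arc_weight p f (u, v) + (\<psi> v - \<psi> u) \<in> {int q..int p - int q}"
  shows "joined p q G f (shift p G f \<psi>)"
  using assms(4-)
proof (induction "nat (\<Sum>v\<in>pverts G. \<psi> v)" arbitrary: f \<phi> \<psi> rule: less_induct)
  case less
  note f = less.prems(1) and \<phi> = less.prems(2) and nonneg = less.prems(3) and ok = less.prems(4)
  interpret pair_graph G by fact
  have "p > 0" using q by simp
  define S where "S = {v \<in> pverts G. 0 < \<psi> v}"
  have "finite S" using pair_finite_verts by (simp add: S_def)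
  show ?case
  proof (cases "S = {}")
    case True
    then have "\<psi> v = 0" if "v \<in> pverts G" for v
      using that nonneg[OF that] by (auto simp: S_def)
    with f have "shift p G f \<psi> = f" by (intro shift_eqI) auto
    with joined_refl[OF f] show ?thesis by simp
  next
    case False
    obtain x where x: "x \<in> S" and least: "\<And>y. y \<in> S \<Longrightarrow> \<phi> x \<le> \<phi> y"
      using ex_is_arg_min_if_finite[OF \<open>finite S\<close> False, of \<phi>]
      by (metis is_arg_min_linorder)
    have xV: "x \<in> pverts G" and x_pos: "0 < \<psi> x" using x by (auto simp: S_def)
    define \<delta> :: "'a \<Rightarrow> int" where "\<delta> v = (if v = x then 1 else 0)" for v
    have \<delta>: "\<delta> x = 1" "\<And>v. v \<noteq> x \<Longrightarrow> \<delta> v = 0" by (simp_all add: \<delta>_def)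
    have bump: "arc_weight p f (u, v) + (\<delta> v - \<delta> u) \<in> {int q..int p - int q}"
      if uv: "(u, v) \<in> parcs G" for u v
    proof -
      have V: "u \<in> pverts G" "v \<in> pverts G" "u \<noteq> v"
        using uv pair_no_loops[OF uv] by (auto dest: wellformed')
      note W = arc_weight_bounds[OF G \<open>q > 0\<close> f uv]
      consider "v = x" | "u = x" | "u \<noteq> x" "v \<noteq> x" by blast
      then show ?thesis
      proof cases
        case 1
        \<comment> \<open>If \<open>u\<close> blocks \<open>x\<close>, the final weight can stay
          within bounds only if \<open>u\<close> rises at least as far as \<open>x\<close>, so
          \<open>u\<close> is in \<open>S\<close>. But
          \<open>\<phi> x - \<phi> u = p - 2 * q > 0\<close> contradicts minimality.\<close>
        have "arc_weight p f (u, v) \<noteq> int p - int q"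
        proof
          assume eq: "arc_weight p f (u, v) = int p - int q"
          with ok[OF uv] x_pos 1 have "0 < \<psi> u" by simp
          with V(1) have "\<phi> x \<le> \<phi> u" by (intro least) (simp add: S_def)
          with \<phi>[OF uv] eq 1 q(2) show False by simp
        qed
        with W V 1 show ?thesis by (simp add: \<delta>)
      next
        case 2
        \<comment> \<open>The same obstruction seen from the reversed arc: here
          \<open>\<phi> v - \<phi> x = 2 * q - p < 0\<close>.\<close>
        have "arc_weight p f (u, v) \<noteq> int q"
        proof
          assume eq: "arc_weight p f (u, v) = int q"
          with ok[OF uv] x_pos 2 have "0 < \<psi> v" by simp
          with V(2) have "\<phi> x \<le> \<phi> v" by (intro least) (simp add: S_def)
          with \<phi>[OF uv] eq 2 q(2) show False by simp
        qed
        with W V 2 show ?thesis by (simp add: \<delta>)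
      next
        case 3
        with W show ?thesis by (simp add: \<delta>)
      qed
    qed
    define h where "h = shift p G f \<delta>"
    have h: "h \<in> colourings p q G"
      unfolding h_def by (rule shift_colouring(1)[OF G \<open>q > 0\<close> \<open>p > 0\<close> bump])
    have Wh: "arc_weight p h (u, v) = arc_weight p f (u, v) + (\<delta> v - \<delta> u)"
      if "(u, v) \<in> parcs G" for u v
      unfolding h_def by (rule shift_colouring(2)[OF G \<open>q > 0\<close> \<open>p > 0\<close> bump that])
    have h_eq: "h v = f v" if "v \<in> pverts G" "v \<noteq> x" for v
    proof -
      have "f v \<in> {0..<int p}" using f that by (auto simp: colourings_def)
      with that show ?thesis by (simp add: h_def shift_def \<delta>)
    qed
    have "card {v \<in> pverts G. f v \<noteq> h v} \<le> card {x}"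
      using h_eq by (intro card_mono) fastforce+
    moreover have "joined p q G h (shift p G h (\<lambda>v. \<psi> v - \<delta> v))"
    proof (rule less.hyps)
      \<comment> \<open>The total drops by one. It was positive, being at least
        \<open>\<psi> x\<close>, so \<open>nat\<close> of it decreases strictly.\<close>
      have "(\<Sum>v\<in>pverts G. \<delta> v) = 1"
        using xV pair_finite_verts by (simp add: \<delta>_def)
      moreover have "\<psi> x \<le> (\<Sum>v\<in>pverts G. \<psi> v)"
        using xV nonneg pair_finite_verts by (intro member_le_sum) auto
      ultimately show "nat (\<Sum>v\<in>pverts G. \<psi> v - \<delta> v) < nat (\<Sum>v\<in>pverts G. \<psi> v)"
        using x_pos by (simp add: sum_subtractf)
    next
      show "h \<in> colourings p q G" by (rule h)
    next
      fix u v assume uv: "(u, v) \<in> parcs G"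
      \<comment> \<open>The potential must follow the weights: as \<open>2 * W\<close> enters, a
        unit step at \<open>x\<close> raises the potential there by 2.\<close>
      show "(\<phi> v + 2 * \<delta> v) - (\<phi> u + 2 * \<delta> u) = 2 * arc_weight p h (u, v) - int p"
        using \<phi>[OF uv] Wh[OF uv] by simp
      show "arc_weight p h (u, v) + (\<psi> v - \<delta> v - (\<psi> u - \<delta> u)) \<in> {int q..int p - int q}"
        using ok[OF uv] Wh[OF uv] by simp
    next
      fix v assume "v \<in> pverts G"
      then show "0 \<le> \<psi> v - \<delta> v" using nonneg[of v] x_pos by (simp add: \<delta>_def)
    qed
    moreover have "shift p G h (\<lambda>v. \<psi> v - \<delta> v) = shift p G f \<psi>"
      by (auto simp: h_def shift_def fun_eq_iff mod_simps)
    ultimately show ?thesis using joined_step[OF f] by simp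
  qed
qed

text \<open>The weight change from \<open>f\<close> to \<open>g\<close> agrees with the coboundary
  of \<open>g - f\<close> up to multiples \<open>p * k\<close>. Equal winds make \<open>k\<close>
  sum to zero on cycles, so \<open>k\<close> has a potential and the whole change is a
  coboundary.\<close>

lemma colouring_difference_shift:
  assumes G: "pair_graph G" and "q > 0" "p > 0"
    and f: "f \<in> colourings p q G" and g: "g \<in> colourings p q G"
    and winds: "\<And>C. graph_cycle G C \<Longrightarrow> wind p f C = wind p g C"
  obtains \<psi> :: "'a \<Rightarrow> int" where "shift p G f \<psi> = g"
    and "\<And>v. v \<in> pverts G \<Longrightarrow> 0 \<le> \<psi> v"
    and "\<And>u v. (u, v) \<in> parcs G \<Longrightarrow>
      arc_weight p g (u, v) = arc_weight p f (u, v) + (\<psi> v - \<psi> u)"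
proof -
  interpret pair_graph G by fact
  define d where "d v = g v - f v" for v
  define r where
    "r e = arc_weight p g e - arc_weight p f e - (d (snd e) - d (fst e))" for e
  define k where "k e = r e div int p" for e
  have r: "r e = int p * k e" for e
  proof -
    have "int p dvd arc_weight p h e - (h (snd e) - h (fst e))" for h
      unfolding arc_weight_def by (simp add: mod_eq_dvd_iff[symmetric])
    from dvd_diff[OF this[of g] this[of f]] show ?thesis by (simp add: k_def r_def d_def algebra_simps)
  qed
  have k_swap: "k (v, u) = - k (u, v)" if uv: "(u, v) \<in> parcs G" for u v
  proof -
    have "r (v, u) = - r (u, v)"
      using colouring_arc_weight_swap[OF G \<open>q > 0\<close> f uv] colouring_arc_weight_swap[OF G \<open>q > 0\<close> g uv]
      by (simp add: r_def)
    then have "int p * (k (v, u) + k (u, v)) = 0" by (simp add: r distrib_left)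
    with \<open>p > 0\<close> show ?thesis by simp
  qed
  have k_cycle: "(\<Sum>e\<leftarrow>C. k e) = 0" if C: "graph_cycle G C" for C
  proof -
    obtain u where u: "pcas u C u" using C by (rule graph_cycleE)
    have "int p * (\<Sum>e\<leftarrow>C. k e) = (\<Sum>e\<leftarrow>C. r e)"
      by (simp add: r sum_list_const_mult)
    also have "\<dots> = cycle_weight p g C - cycle_weight p f C - (\<Sum>e\<leftarrow>C. d (snd e) - d (fst e))"
      by (simp add: r_def sum_list_subtractf cycle_weight_def)
    also have "\<dots> = 0"
      using winds[OF C] by (simp add: pcas_sum_coboundary[OF u] cycle_weight_eq_wind[OF C])
    finally show ?thesis using \<open>p > 0\<close> by simp
  qed
  \<comment> \<open>Integrating \<open>k\<close> rather than the weight change itself keeps the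
    displacement congruent to \<open>g - f\<close> modulo \<open>p\<close> at every vertex, in every
    component.\<close>
  obtain \<kappa> where \<kappa>: "\<And>u v. (u, v) \<in> parcs G \<Longrightarrow> \<kappa> v - \<kappa> u = k (u, v)"
    using potential_exists[of k] k_swap k_cycle by blast
  \<comment> \<open>A common bound for the absolute displacements. Adding \<open>p * N\<close> makes
    them nonnegative and alters neither residues nor differences.\<close>
  define N where "N = (\<Sum>v\<in>pverts G. \<bar>d v + int p * \<kappa> v\<bar>)"
  define \<psi> where "\<psi> v = d v + int p * \<kappa> v + int p * N" for v
  show ?thesis
  proof (rule that)
    show "shift p G f \<psi> = g"
      using g by (rule shift_eqI) (simp add: \<psi>_def d_def)
  next
    fix v assume "v \<in> pverts G"
    then have "\<bar>d v + int p * \<kappa> v\<bar> \<le> N"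
      unfolding N_def using pair_finite_verts by (intro member_le_sum) auto
    moreover from this have "1 * N \<le> int p * N"
      using \<open>p > 0\<close> by (intro mult_right_mono) auto
    ultimately show "0 \<le> \<psi> v" by (simp add: \<psi>_def)
  next
    fix u v assume uv: "(u, v) \<in> parcs G"
    have "\<psi> v - \<psi> u = d v - d u + int p * (\<kappa> v - \<kappa> u)"
      by (simp add: \<psi>_def algebra_simps)
    also have "\<dots> = d v - d u + r (u, v)" by (simp add: \<kappa>[OF uv] r)
    finally show "arc_weight p g (u, v) = arc_weight p f (u, v) + (\<psi> v - \<psi> u)"
      by (simp add: r_def)
  qed
qed

text \<open>The hypothesis enters twice: equal winds of \<open>f\<close> and \<open>g\<close> give
  the displacement \<open>\<psi>\<close>, and the exact value makes \<open>2 * W - p\<close> sum to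
  zero on cycles, which gives the potential \<open>\<phi>\<close>.\<close>

lemma wind_imp_mixing:
  assumes G: "pair_graph G" and q: "q > 0" "2 * q < p"
    and winds: "\<And>f C. f \<in> colourings p q G \<Longrightarrow> graph_cycle G C \<Longrightarrow>
      2 * wind p f C = int (length C)"
  shows "mixing p q G"
proof -
  interpret pair_graph G by fact
  have "p > 0" using q by simp
  have "joined p q G f g" if f: "f \<in> colourings p q G" and g: "g \<in> colourings p q G" for f g
  proof -
    have "wind p f C = wind p g C" if "graph_cycle G C" for C
      using winds[OF f that] winds[OF g that] by simp
    then obtain \<psi> where \<psi>: "shift p G f \<psi> = g" "\<And>v. v \<in> pverts G \<Longrightarrow> 0 \<le> \<psi> v"
      "\<And>u v. (u, v) \<in> parcs G \<Longrightarrow>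
        arc_weight p g (u, v) = arc_weight p f (u, v) + (\<psi> v - \<psi> u)"
      using colouring_difference_shift[OF G \<open>q > 0\<close> \<open>p > 0\<close> f g] by metis
    define w where "w e = 2 * arc_weight p f e - int p" for e
    have "w (v, u) = - w (u, v)" if "(u, v) \<in> parcs G" for u v
      using colouring_arc_weight_swap[OF G \<open>q > 0\<close> f that] by (simp add: w_def)
    moreover have "(\<Sum>e\<leftarrow>C. w e) = 0" if C: "graph_cycle G C" for C
    proof -
      have "(\<Sum>e\<leftarrow>C. w e) = 2 * cycle_weight p f C - int (length C) * int p"
        by (simp add: w_def sum_list_subtractf sum_list_const_mult sum_list_triv cycle_weight_def)
      also have "\<dots> = 0"
        by (simp add: cycle_weight_eq_wind[OF C] flip: winds[OF f C])
      finally show ?thesis .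
    qed
    ultimately obtain \<phi> where "\<And>u v. (u, v) \<in> parcs G \<Longrightarrow> \<phi> v - \<phi> u = w (u, v)"
      using potential_exists[of w] by blast
    then have "joined p q G f (shift p G f \<psi>)"
      \<comment> \<open>The range condition of \<open>joined_shift\<close> is the bound on the
        weights of \<open>g\<close>, read through \<open>\<psi>(3)\<close>.\<close>
      using \<psi>(2) arc_weight_bounds[OF G \<open>q > 0\<close> g]
      by (intro joined_shift[OF G q f]) (auto simp: w_def simp flip: \<psi>(3))
    then show ?thesis by (simp add: \<psi>(1))
  qed
  then show ?thesis by (simp add: mixing_def joined_def)
qed

theorem theorem2p5:
  fixes p q :: nat and G :: "'a pair_pre_digraph"
  assumes "p > 0" and "q > 0"
    and "2 < real p / real q" and "real p / real q < 4"
    and "pair_graph G"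
  shows "mixing p q G \<longleftrightarrow>
    (\<forall>f \<in> colourings p q G. \<forall>C. graph_cycle G C \<longrightarrow>
      real_of_int (wind p f C) = real (length C) / 2)"
proof -
  have "real (2 * q) < real p" "real p < real (4 * q)"
    using assms(2-4) by (simp_all add: field_simps)
  then have pq: "2 * q < p" "p < 4 * q" unfolding of_nat_less_iff by blast+
  have half: "real_of_int (wind p f C) = real (length C) / 2 \<longleftrightarrow>
      2 * wind p f C = int (length C)" for f C
    by linarith
  show ?thesis
    unfolding half
    using mixing_imp_wind[OF assms(5,2,1) pq(2)] wind_imp_mixing[OF assms(5,2) pq(1)] by blast
qed

end
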